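(* Let $a,r\in(0,\infty)$ and $b,c\in(1,\infty)$. Let $f,g:(0,\infty)\to[0,\infty)$ be measurable functions, and assume $g$ is $c$-adically increasing. If $f$ is $b$-almost increasing, then $$\int_0^rg(t)f(t)t^{a-1}\,dt\ge\frac{a(r/c)^{-a}}{b^3}\Big(\int_0^rg(t)t^{a-1}\,dt\Big)\Big(\int_0^{r/c}f(t)t^{a-1}\,dt\Big),$$ $$\int_r^\infty g(t)f(t)t^{-a-1}\,dt\ge\frac{a(r/c)^a}{b^3}\Big(\int_r^\infty g(t)t^{-a-1}\,dt\Big)\Big(\int_{r/c}^\infty f(t)t^{-a-1}\,dt\Big).$$ If $f$ is $b$-almost decreasing, then $$\int_0^rg(t)f(t)t^{a-1}\,dt\le a(r/c)^{-a}b^3\Big(\int_0^rg(t)t^{a-1}\,dt\Big)\Big(\int_0^{r/c}f(t)t^{a-1}\,dt\Big),$$ $$\int_r^\infty g(t)f(t)t^{-a-1}\,dt\le a(r/c)^ab^3\Big(\int_r^\infty g(t)t^{-a-1}\,dt\Big)\Big(\int_{r/c}^\infty f(t)t^{-a-1}\,dt\Big).$$ Moreover, if $g$ is monotone (in the ordinary sense), then $b^3$ can be replaced by $b$ in all these estimates.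
   Context: $g$ is $c$-adically increasing if $g(ct)\ge g(t)$ for all $t>0$. $f$ is $b$-almost decreasing if $x\le y$ implies $f(y)\le bf(x)$, and $b$-almost increasing if $x\le y$ implies $f(x)\le bf(y)$. Integrals take values in $[0,\infty]$. *)

theory Defs
  imports "HOL-Analysis.Analysis"
begin

text \<open>
  A function on \<open>(0, \<infinity>)\<close> is represented by a total function on the reals, of which
  only the values at positive arguments matter.
\<close>

definition adically_increasing :: "real \<Rightarrow> (real \<Rightarrow> real) \<Rightarrow> bool" where
  "adically_increasing c g \<longleftrightarrow> (\<forall>t>0. g (c * t) \<ge> g t)"

definition almost_decreasing :: "real \<Rightarrow> (real \<Rightarrow> real) \<Rightarrow> bool" where
  "almost_decreasing b f \<longleftrightarrow> (\<forall>x>0. \<forall>y>0. x \<le> y \<longrightarrow> f y \<le> b * f x)"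

definition almost_increasing :: "real \<Rightarrow> (real \<Rightarrow> real) \<Rightarrow> bool" where
  "almost_increasing b f \<longleftrightarrow> (\<forall>x>0. \<forall>y>0. x \<le> y \<longrightarrow> f x \<le> b * f y)"

end

theory Submission
  imports Defs
begin

text \<open>
  The four estimates are Chebyshev's inequality along geometric progressions. Write \<open>D\<close> for
  \<open>(0, r)\<close> or \<open>(r, \<infinity>)\<close> and \<open>e = a\<close> or \<open>e = - a\<close> accordingly, so that all integrals carry the
  weight \<open>t powr (e - 1)\<close>, and put \<open>D' = D / c\<close>, the domain over which \<open>f\<close> is averaged. With
  \<open>q = 1 / c\<close> or \<open>q = c\<close>, the set \<open>D\<close> is the disjoint union of the dilates \<open>q ^ k J\<close> of one cell \<open>J\<close>,
  which is \<open>[r / c, r)\<close> or \<open>(r, r c]\<close>, and \<open>D'\<close> is in the same way the union of the dilates of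
  \<open>J' = J / c\<close>. Substituting on each dilate (\<open>mellin_fold\<close>) turns the integral of
  \<open>h\<close> over \<open>D\<close> into the integral over \<open>s \<in> J\<close> of the orbit sum \<open>\<Sum>k. \<rho> ^ k * h (q ^ k * s)\<close> with
  \<open>\<rho> = q powr e\<close>, against the same weight.

  Suppose first that \<open>f\<close> is monotone. For fixed \<open>s\<close>, being \<open>c\<close>-adically increasing says precisely that
  \<open>g\<close> is monotone along the orbit \<open>q ^ k s\<close>, so there \<open>f\<close> and \<open>g\<close> are either ordered similarly or
  ordered oppositely, and Chebyshev's inequality for sums compares the orbit sum of \<open>g f\<close> times
  the orbit sum of \<open>1\<close> with the orbit sum of \<open>g\<close> times that of \<open>f\<close>. Every point of \<open>J'\<close> lies to the left of every point of \<open>J\<close>,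
  so monotonicity also compares the last factor at \<open>s\<close> with its value at every \<open>u \<in> J'\<close>. Averaging over
  \<open>u\<close> replaces that factor by the integral of \<open>f\<close> over \<open>D'\<close>. The outcome (\<open>mono_product_ge\<close>,
  \<open>antimono_product_le\<close>) is a comparison, with no loss of constant, of \<open>N\<close> times the integral of \<open>g f\<close>
  over \<open>D\<close> with the product of the integrals of \<open>g\<close> over \<open>D\<close> and of \<open>f\<close> over \<open>D'\<close>, where
  \<open>N\<close>, the integral of the weight over \<open>D'\<close>, is \<open>(r / c) powr e / a\<close>.

  An almost monotone \<open>f\<close> lies within a factor \<open>b\<close> of a monotone function, namely its supremum over
  \<open>(0, x]\<close> or over \<open>[x, \<infinity>)\<close> (\<open>almost_increasing_envelope\<close>, \<open>almost_decreasing_envelope\<close>). This costs a single factor \<open>b\<close>, and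
  \<open>b \<le> b ^ 3\<close>. Everything is carried out in \<open>[0, \<infinity>]\<close>, so divergent integrals need no separate treatment.
\<close>

section \<open>Chebyshev's sum inequality in the extended nonnegative reals\<close>

lemma suminf_swap_ennreal:
  fixes A :: "nat \<Rightarrow> nat \<Rightarrow> ennreal"
  shows "(\<Sum>j. \<Sum>k. A j k) = (\<Sum>k. \<Sum>j. A j k)"
proof -
  have "(\<Sum>j. \<Sum>k. A j k) = (\<Sum>j. \<integral>\<^sup>+k. A j k \<partial>count_space UNIV)"
    by (simp add: nn_integral_count_space_nat)
  also have "\<dots> = (\<integral>\<^sup>+k. (\<Sum>j. A j k) \<partial>count_space UNIV)"
    by (rule nn_integral_suminf[symmetric]) simp
  finally show ?thesis
    by (simp add: nn_integral_count_space_nat)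
qed

text \<open>
  Symmetrizing the double sums over \<open>(j, k)\<close> avoids the subtraction in the usual identity
  behind Chebyshev's inequality, which is not available when sums may be infinite: the two sides are
  compared term by term instead.
\<close>

lemma Chebyshev_suminf_symmetrized:
  fixes w x y :: "nat \<Rightarrow> ennreal"
  shows "2 * ((\<Sum>k. w k) * (\<Sum>k. w k * (x k * y k)))
       = (\<Sum>j. \<Sum>k. w j * w k * (x j * y j + x k * y k))" (is ?diagonal)
    and "2 * ((\<Sum>k. w k * x k) * (\<Sum>k. w k * y k))
       = (\<Sum>j. \<Sum>k. w j * w k * (x j * y k + x k * y j))" (is ?mixed)
proof -
  have product: "(\<Sum>j. u j) * (\<Sum>k. v k) = (\<Sum>j. \<Sum>k. u j * v k)" for u v :: "nat \<Rightarrow> ennreal"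
    by simp
  have double: "2 * ((\<Sum>j. u j) * (\<Sum>k. v k)) = (\<Sum>j. \<Sum>k. u j * v k + u k * v j)"
    for u v :: "nat \<Rightarrow> ennreal"
  proof -
    have "2 * ((\<Sum>j. u j) * (\<Sum>k. v k)) = (\<Sum>j. \<Sum>k. u j * v k) + (\<Sum>j. \<Sum>k. u k * v j)"
      unfolding mult_2 product by (subst (2) suminf_swap_ennreal) simp
    then show ?thesis
      by (simp only: suminf_add[OF summableI summableI])
  qed
  show ?diagonal
    unfolding double by (intro suminf_cong) (simp add: algebra_simps)
  show ?mixed
    unfolding double by (intro suminf_cong) (simp add: algebra_simps)
qed

lemma Chebyshev_suminf_le:
  fixes w x y :: "nat \<Rightarrow> ennreal"
  assumes "\<And>j k. x j * y j + x k * y k \<le> x j * y k + x k * y j"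
  shows "(\<Sum>k. w k) * (\<Sum>k. w k * (x k * y k)) \<le> (\<Sum>k. w k * x k) * (\<Sum>k. w k * y k)"
proof -
  have "2 * ((\<Sum>k. w k) * (\<Sum>k. w k * (x k * y k)))
      \<le> 2 * ((\<Sum>k. w k * x k) * (\<Sum>k. w k * y k))"
    unfolding Chebyshev_suminf_symmetrized
    by (intro suminf_le summableI mult_left_mono assms) simp
  then show ?thesis
    by (simp add: ennreal_mult_le_mult_iff)
qed

lemma Chebyshev_suminf_ge:
  fixes w x y :: "nat \<Rightarrow> ennreal"
  assumes "\<And>j k. x j * y k + x k * y j \<le> x j * y j + x k * y k"
  shows "(\<Sum>k. w k * x k) * (\<Sum>k. w k * y k) \<le> (\<Sum>k. w k) * (\<Sum>k. w k * (x k * y k))"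
proof -
  have "2 * ((\<Sum>k. w k * x k) * (\<Sum>k. w k * y k))
      \<le> 2 * ((\<Sum>k. w k) * (\<Sum>k. w k * (x k * y k)))"
    unfolding Chebyshev_suminf_symmetrized
    by (intro suminf_le summableI mult_left_mono assms) simp
  then show ?thesis
    by (simp add: ennreal_mult_le_mult_iff)
qed

text \<open>
  The two sides differ by \<open>d * e\<close>, where \<open>d\<close> and \<open>e\<close> are the increments of \<open>x\<close> and \<open>y\<close>.
\<close>

lemma rearrangement_ennreal:
  fixes x x' y y' :: ennreal
  assumes "x \<le> x'" "y \<le> y'"
  shows "x * y' + x' * y \<le> x * y + x' * y'"
proof -
  obtain d e where "x' = x + d" "y' = y + e"
    using assms by (auto simp: le_iff_add)
  then show ?thesis
    by (simp add: algebra_simps add_left_mono)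
qed

section \<open>Weighted integrals and geometric tilings\<close>

text \<open>
  The truncated Mellin transform at \<open>e\<close>; both families of integrals in the theorem have this form, with
  \<open>e = a\<close> near zero and \<open>e = - a\<close> near infinity.
\<close>

definition mellin :: "real \<Rightarrow> real set \<Rightarrow> (real \<Rightarrow> ennreal) \<Rightarrow> ennreal" where
  "mellin e D h = (\<integral>\<^sup>+t\<in>D. h t * ennreal (t powr (e - 1)) \<partial>lebesgue)"

lemma mellin_mono:
  assumes "\<And>t. t \<in> D \<Longrightarrow> h t \<le> h' t"
  shows "mellin e D h \<le> mellin e D h'"
  unfolding mellin_def using assms
  by (intro nn_integral_mono) (auto split: split_indicator intro: mult_right_mono)

lemma powr_measurable_lebesgue [measurable]:
  "(\<lambda>t::real. ennreal (t powr p)) \<in> borel_measurable lebesgue"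
  by (rule measurable_completion) measurable

lemma mellin_cmult:
  assumes [measurable]: "h \<in> borel_measurable lebesgue" "D \<in> sets lebesgue"
  shows "mellin e D (\<lambda>t. C * h t) = C * mellin e D h"
  unfolding mellin_def by (subst nn_integral_cmult[symmetric]) (auto simp: mult.assoc)

text \<open>
  The dilate \<open>q ^ k J\<close> is written as a preimage, which makes its measurability immediate and lets
  membership be decided by arithmetic on \<open>t / q ^ k\<close>.
\<close>

definition geometric_tiling :: "real \<Rightarrow> real set \<Rightarrow> real set \<Rightarrow> bool" where
  "geometric_tiling q J D \<longleftrightarrow>
     J \<in> sets lebesgue \<and> J \<subseteq> {0<..} \<and>
     disjoint_family (\<lambda>k::nat. {t. t / q ^ k \<in> J}) \<and> (\<Union>k. {t. t / q ^ k \<in> J}) = D"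

lemma scale_measurable_lebesgue [measurable]:
  "(\<lambda>t::real. p * t) \<in> measurable lebesgue lebesgue"
proof -
  have "(\<lambda>t::real. p * t) = (*\<^sub>R) p"
    by (simp add: fun_eq_iff)
  then show ?thesis
    by (simp only: lebesgue_measurable_scaling)
qed

lemma dilate_measurable [measurable (raw)]:
  fixes h :: "real \<Rightarrow> ennreal"
  assumes "h \<in> borel_measurable lebesgue"
  shows "(\<lambda>t. h (p * t)) \<in> borel_measurable lebesgue"
  using measurable_compose[OF scale_measurable_lebesgue assms] .

lemma dilate_set_measurable:
  fixes J :: "real set"
  assumes "J \<in> sets lebesgue"
  shows "{t. t / p \<in> J} \<in> sets lebesgue"
  using measurable_sets[OF scale_measurable_lebesgue[of "1 / p"] assms]
  by (simp add: vimage_def)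

text \<open>
  The measure \<open>t powr (e - 1) dt\<close> is homogeneous of degree \<open>e\<close> under dilations.
\<close>

lemma mellin_dilate:
  assumes "p > 0" and [measurable]: "h \<in> borel_measurable lebesgue" "J \<in> sets lebesgue"
    and pos: "J \<subseteq> {0<..}"
  shows "mellin e {t. t / p \<in> J} h = mellin e J (\<lambda>s. ennreal (p powr e) * h (p * s))"
proof -
  have [measurable]: "{t. t / p \<in> J} \<in> sets lebesgue"
    by (rule dilate_set_measurable) fact
  have "mellin e {t. t / p \<in> J} h
      = ennreal \<bar>p\<bar> * (\<integral>\<^sup>+s. h (0 + p * s) * ennreal ((0 + p * s) powr (e - 1))
                          * indicator {t. t / p \<in> J} (0 + p * s) \<partial>lebesgue)"
    unfolding mellin_def
    by (rule nn_integral_real_affine_lebesgue) (use assms in auto)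
  also have "\<dots> = (\<integral>\<^sup>+s. ennreal p * (h (p * s) * ennreal ((p * s) powr (e - 1))
                          * indicator J s) \<partial>lebesgue)"
    using \<open>p > 0\<close> by (subst nn_integral_cmult) (auto simp: indicator_def)
  also have "\<dots> = mellin e J (\<lambda>s. ennreal (p powr e) * h (p * s))"
    unfolding mellin_def
  proof (intro nn_integral_cong)
    fix s
    have "ennreal p * ennreal ((p * s) powr (e - 1)) = ennreal (p powr e) * ennreal (s powr (e - 1))"
      if "s \<in> J"
      using that pos \<open>p > 0\<close>
      by (subst (1 2) ennreal_mult[symmetric]) (auto simp: powr_mult powr_diff)
    then show "ennreal p * (h (p * s) * ennreal ((p * s) powr (e - 1)) * indicator J s)
        = ennreal (p powr e) * h (p * s) * ennreal (s powr (e - 1)) * indicator J s"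
      by (auto split: split_indicator simp: ac_simps) (metis mult.left_commute)
  qed
  finally show ?thesis .
qed

lemma geometric_tiling_pos:
  assumes "q > 0" "geometric_tiling q J D" "t \<in> D"
  shows "0 < t"
proof -
  obtain k where "t / q ^ k \<in> J"
    using assms by (auto simp: geometric_tiling_def)
  then have "0 < t / q ^ k"
    using assms by (auto simp: geometric_tiling_def)
  then show ?thesis
    using assms by (simp add: zero_less_divide_iff)
qed

lemma geometric_tiling_measurable:
  assumes "geometric_tiling q J D"
  shows "D \<in> sets lebesgue"
proof -
  have "(\<Union>k. {t. t / q ^ k \<in> J}) \<in> sets lebesgue"
    using assms by (intro sets.countable_UN) (auto intro: dilate_set_measurable simp: geometric_tiling_def)
  then show ?thesis
    using assms by (simp add: geometric_tiling_def)
qed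

text \<open>
  Folding an integral over a tiled domain onto one cell: the weight is homogeneous, so the
  \<open>k\<close>-th dilate contributes with the constant factor \<open>(q powr e) ^ k\<close>.
\<close>

lemma mellin_fold:
  assumes "q > 0" "geometric_tiling q J D" and [measurable]: "h \<in> borel_measurable lebesgue"
  shows "mellin e D h = mellin e J (\<lambda>s. \<Sum>k. ennreal (q powr e) ^ k * h (q ^ k * s))"
proof -
  have [measurable]: "J \<in> sets lebesgue" "\<And>k::nat. {t. t / q ^ k \<in> J} \<in> sets lebesgue"
    using assms dilate_set_measurable by (auto simp: geometric_tiling_def)
  have "mellin e D h = (\<Sum>k. mellin e {t. t / q ^ k \<in> J} h)"
    using assms unfolding mellin_def geometric_tiling_def
    by (subst nn_integral_disjoint_family[symmetric]) auto
  also have "\<dots> = (\<Sum>k. mellin e J (\<lambda>s. ennreal (q powr e) ^ k * h (q ^ k * s)))"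
  proof (rule suminf_cong)
    fix k
    have "ennreal ((q ^ k) powr e) = ennreal (q powr e) ^ k"
      using \<open>q > 0\<close> by (simp add: ennreal_power powr_power powr_realpow[symmetric] powr_powr mult.commute)
    then show "mellin e {t. t / q ^ k \<in> J} h = mellin e J (\<lambda>s. ennreal (q powr e) ^ k * h (q ^ k * s))"
      using assms by (subst mellin_dilate) (auto simp: geometric_tiling_def)
  qed
  also have "\<dots> = mellin e J (\<lambda>s. \<Sum>k. ennreal (q powr e) ^ k * h (q ^ k * s))"
    unfolding mellin_def
    by (subst nn_integral_suminf[symmetric]) (auto simp flip: ennreal_suminf_multc)
  finally show ?thesis .
qed

section \<open>Tilings of the two half-lines\<close>

lemma geometric_cell:
  fixes c x :: real
  assumes "c > 1" "x > 1"
  obtains k :: nat where "c ^ k < x" "x \<le> c ^ Suc k"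
proof -
  obtain n where "x \<le> c ^ n"
    using real_arch_pow[OF \<open>c > 1\<close>, of x] less_imp_le by blast
  define m where "m = (LEAST n. x \<le> c ^ n)"
  have m: "x \<le> c ^ m"
    unfolding m_def using \<open>x \<le> c ^ n\<close> by (rule LeastI)
  with \<open>x > 1\<close> obtain k where k: "m = Suc k"
    by (cases m) auto
  have "\<not> x \<le> c ^ k"
    using k not_less_Least[of k "\<lambda>n. x \<le> c ^ n"] by (simp add: m_def)
  then show ?thesis
    using m k that[of k] by (simp add: not_le)
qed

lemma geometric_cell_unique:
  fixes c x :: real
  assumes "c > 1" "c ^ j < x" "x \<le> c ^ Suc j" "c ^ k < x" "x \<le> c ^ Suc k"
  shows "j = k"
proof -
  have "c ^ j < c ^ Suc k" "c ^ k < c ^ Suc j"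
    using assms by linarith+
  then have "j < Suc k" "k < Suc j"
    using power_less_imp_less_exp[OF \<open>c > 1\<close>] by blast+
  then show ?thesis
    by simp
qed

text \<open>
  A common criterion for both half-lines: \<open>x t\<close> measures the multiplicative distance of \<open>t\<close> from the endpoint
  \<open>r\<close>, so it is \<open>r / t\<close> on \<open>(0, r)\<close> and \<open>t / r\<close> on \<open>(r, \<infinity>)\<close>. In this coordinate the cells
  are the intervals \<open>(c ^ k, c ^ (k + 1)]\<close>.
\<close>

lemma geometric_tilingI:
  fixes c q :: real and x :: "real \<Rightarrow> real"
  assumes c: "c > 1" and J: "J \<in> sets lebesgue" "J \<subseteq> {0<..}"
    and cell: "\<And>t k. t / q ^ k \<in> J \<longleftrightarrow> c ^ k < x t \<and> x t \<le> c ^ Suc k"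
    and D: "D = {t. 1 < x t}"
  shows "geometric_tiling q J D"
  unfolding geometric_tiling_def disjoint_family_on_def cell D
proof (intro conjI J ballI impI)
  fix j k :: nat assume "j \<noteq> k"
  then show "{t. c ^ j < x t \<and> x t \<le> c ^ Suc j} \<inter> {t. c ^ k < x t \<and> x t \<le> c ^ Suc k} = {}"
    using geometric_cell_unique[of c j] c by blast
next
  have "(\<exists>k. c ^ k < x t \<and> x t \<le> c ^ Suc k) \<longleftrightarrow> 1 < x t" for t
  proof
    assume "\<exists>k. c ^ k < x t \<and> x t \<le> c ^ Suc k"
    then obtain k where "c ^ k < x t"
      by blast
    then show "1 < x t"
      using one_le_power[of c k] c by linarith
  next
    assume "1 < x t"
    then show "\<exists>k. c ^ k < x t \<and> x t \<le> c ^ Suc k"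
      by (rule geometric_cell[OF c]) blast
  qed
  then show "(\<Union>k. {t. c ^ k < x t \<and> x t \<le> c ^ Suc k}) = {t. 1 < x t}"
    by (simp only: set_eq_iff UN_iff mem_Collect_eq UNIV_I simp_thms bex_UNIV)
qed

lemma tiling_towards_zero:
  assumes "c > 1" "r > 0"
  shows "geometric_tiling (1 / c) {r / c..<r} {0<..<r}"
proof (rule geometric_tilingI[OF \<open>c > 1\<close>])
  show "{r / c..<r} \<subseteq> {0<..}"
    using assms by (auto intro: less_le_trans[of 0 "r / c"])
  show "t / (1 / c) ^ k \<in> {r / c..<r} \<longleftrightarrow> c ^ k < r / t \<and> r / t \<le> c ^ Suc k" for t k
  proof (cases "t > 0")
    case True
    then show ?thesis
      using assms by (auto simp: field_simps)
  next
    case False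
    then have "t / (1 / c) ^ k \<le> 0" "r / t \<le> 0"
      using assms by (auto simp: divide_nonpos_nonneg divide_nonneg_nonpos)
    moreover have "0 < r / c" "0 < c ^ k"
      using assms by auto
    ultimately show ?thesis
      unfolding atLeastLessThan_iff by linarith
  qed
  have "t \<in> {0<..<r} \<longleftrightarrow> 1 < r / t" for t
    using assms by (cases "t > 0") (simp_all add: less_divide_eq)
  then show "{0<..<r} = {t. 1 < r / t}"
    by blast
qed simp

lemma tiling_towards_infinity:
  assumes "c > 1" "r > 0"
  shows "geometric_tiling c {r<..r * c} {r<..}"
proof (rule geometric_tilingI[OF \<open>c > 1\<close>])
  show "t / c ^ k \<in> {r<..r * c} \<longleftrightarrow> c ^ k < t / r \<and> t / r \<le> c ^ Suc k" for t k
    using assms by (simp add: less_divide_eq divide_le_eq mult_ac)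
  show "{r<..r * c} \<subseteq> {0<..}"
    using assms by auto
  show "{r<..} = {t. 1 < t / r}"
    using assms by (simp add: less_divide_eq greaterThan_def)
qed simp

section \<open>Monotone envelopes of almost monotone functions\<close>

lemma mono_ennreal_borel:
  fixes F :: "real \<Rightarrow> ennreal"
  assumes "mono F"
  shows "F \<in> borel_measurable borel"
proof (rule borel_measurableI_greater)
  fix y
  have "is_interval {x. y < F x}"
    unfolding is_interval_1 using assms by (auto simp: mono_def intro: less_le_trans)
  then show "{x \<in> space borel. y < F x} \<in> sets borel"
    using real_interval_borel_measurable by simp
qed

lemma antimono_ennreal_borel:
  fixes F :: "real \<Rightarrow> ennreal"
  assumes "antimono F"
  shows "F \<in> borel_measurable borel"
proof (rule borel_measurableI_greater)
  fix y
  have "is_interval {x. y < F x}"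
    unfolding is_interval_1 using assms by (auto simp: antimono_def intro: less_le_trans)
  then show "{x \<in> space borel. y < F x} \<in> sets borel"
    using real_interval_borel_measurable by simp
qed

text \<open>
  The running supremum \<open>F x\<close> of \<open>f\<close> over \<open>(0, x]\<close> is monotone, and each value in it is at most \<open>B * f x\<close>
  by hypothesis. Being monotone,
  \<open>F\<close> is measurable. For an almost decreasing \<open>f\<close> the supremum over \<open>[x, \<infinity>)\<close> does the same.
\<close>

lemma almost_increasing_envelope:
  fixes f :: "real \<Rightarrow> ennreal"
  assumes "\<And>x y. 0 < x \<Longrightarrow> x \<le> y \<Longrightarrow> f x \<le> B * f y"
  obtains F where "mono F" "F \<in> borel_measurable lebesgue"
    "\<And>x. 0 < x \<Longrightarrow> f x \<le> F x" "\<And>x. 0 < x \<Longrightarrow> F x \<le> B * f x"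
proof
  let ?F = "\<lambda>x. SUP y\<in>{0<..x}. f y"
  show "mono ?F"
    by (intro monoI SUP_subset_mono) auto
  then show "?F \<in> borel_measurable lebesgue"
    by (intro measurable_completion) (simp add: mono_ennreal_borel)
qed (auto intro!: SUP_upper SUP_least intro: assms)

lemma almost_decreasing_envelope:
  fixes f :: "real \<Rightarrow> ennreal"
  assumes "\<And>x y. 0 < x \<Longrightarrow> x \<le> y \<Longrightarrow> f y \<le> B * f x"
  obtains F where "antimono F" "F \<in> borel_measurable lebesgue"
    "\<And>x. 0 < x \<Longrightarrow> f x \<le> F x" "\<And>x. 0 < x \<Longrightarrow> F x \<le> B * f x"
proof
  let ?F = "\<lambda>x. SUP y\<in>{0<..} \<inter> {x..}. f y"
  show "antimono ?F"
    by (intro antimonoI SUP_subset_mono) auto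
  then show "?F \<in> borel_measurable lebesgue"
    by (intro measurable_completion) (simp add: antimono_ennreal_borel)
qed (auto intro!: SUP_upper SUP_least intro: assms)

section \<open>Orbitwise comparison\<close>

text \<open>
  Of two points on one orbit \<open>q ^ k s\<close> the larger is the smaller times a power \<open>c ^ n\<close>, so
  \<open>g\<close> is monotone along the orbit.
\<close>

lemma adically_increasing_powers:
  fixes g :: "real \<Rightarrow> 'a::preorder"
  assumes c: "c > 1" and q: "q = c \<or> q = 1 / c"
    and g: "\<forall>t>0. g t \<le> g (c * t)"
    and s: "0 < s" and le: "q ^ j * s \<le> q ^ k * s"
  shows "g (q ^ j * s) \<le> g (q ^ k * s)"
proof -
  have iterate: "g t \<le> g (c ^ n * t)" if "0 < t" for t n
  proof (induction n)
    case (Suc n)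
    have "g (c ^ n * t) \<le> g (c * (c ^ n * t))"
      using c that g by simp
    with Suc show ?case
      by (auto simp: mult.assoc intro: order_trans)
  qed simp
  have "\<exists>n. q ^ k = c ^ n * q ^ j"
    using q
  proof
    assume "q = c"
    with le s c have "j \<le> k"
      by simp
    then have "c ^ k = c ^ (k - j) * c ^ j"
      by (simp flip: power_add)
    with \<open>q = c\<close> show ?thesis
      by blast
  next
    assume "q = 1 / c"
    with le s c have "k \<le> j"
      by (simp add: field_simps)
    then have "c ^ j = c ^ (j - k) * c ^ k"
      by (simp flip: power_add)
    then have "(1 / c) ^ k = c ^ (j - k) * (1 / c) ^ j"
      using c by (simp add: power_one_over)
    with \<open>q = 1 / c\<close> show ?thesis
      by blast
  qed
  then obtain n where n: "q ^ k = c ^ n * q ^ j" ..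
  have "0 < q ^ j * s"
    using q c s by auto
  from iterate[OF this, of n] show ?thesis
    by (simp add: n mult.assoc)
qed

section \<open>Passing to functions on the whole line\<close>

text \<open>
  Only the values on \<open>(0, \<infinity>)\<close> of the functions in the theorem are known to be measurable and nonnegative;
  extending by \<open>0\<close> gives functions that are measurable on the whole line.
\<close>

definition zero_ext :: "(real \<Rightarrow> real) \<Rightarrow> real \<Rightarrow> ennreal" where
  "zero_ext h t = (if t \<in> {0<..} then ennreal (h t) else 0)"

lemma zero_ext_measurable:
  assumes "h \<in> borel_measurable (lebesgue_on {0<..})"
  shows "zero_ext h \<in> borel_measurable lebesgue"
proof -
  have "(\<lambda>t. ennreal (h t)) \<in> borel_measurable (lebesgue_on {0<..})"
    using assms by measurable
  then show ?thesis
    unfolding zero_ext_def[abs_def]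
    by (subst measurable_restrict_space_iff[symmetric]) auto
qed

lemma mellin_zero_ext:
  assumes "h \<in> {0<..} \<rightarrow> {0..}" "D \<subseteq> {0<..}"
  shows "mellin e D (zero_ext h) = (\<integral>\<^sup>+t\<in>D. ennreal (h t * t powr (e - 1)) \<partial>lebesgue)"
  unfolding mellin_def using assms
  by (intro nn_integral_cong) (auto simp: zero_ext_def Pi_iff subset_iff simp flip: ennreal_mult split: split_indicator)

lemma mellin_zero_ext_product:
  assumes "g \<in> {0<..} \<rightarrow> {0..}" "f \<in> {0<..} \<rightarrow> {0..}" "D \<subseteq> {0<..}"
  shows "mellin e D (\<lambda>t. zero_ext g t * zero_ext f t)
       = (\<integral>\<^sup>+t\<in>D. ennreal (g t * f t * t powr (e - 1)) \<partial>lebesgue)"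
  unfolding mellin_def using assms
  by (intro nn_integral_cong) (auto simp: zero_ext_def Pi_iff subset_iff simp flip: ennreal_mult split: split_indicator)

section \<open>Product estimates for two tiled domains\<close>

text \<open>
  The common setting of the estimates on \<open>(0, r)\<close> and on \<open>(r, \<infinity>)\<close>. The orbits run
  away from \<open>r\<close>: towards \<open>0\<close> for \<open>q = 1 / c\<close>, towards \<open>\<infinity>\<close> for \<open>q = c\<close>. In
  both cases the cell \<open>J'\<close> of \<open>D' = D / c\<close> lies to the left of the cell \<open>J\<close> of \<open>D\<close>.
\<close>

locale two_tilings =
  fixes c q e :: real and J D J' D' :: "real set"
  assumes base: "c > 1"
    and ratio: "q = c \<or> q = 1 / c"
    and tiling: "geometric_tiling q J D"
    and tiling': "geometric_tiling q J' D'"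
    and cell_order: "\<And>s u. s \<in> J \<Longrightarrow> u \<in> J' \<Longrightarrow> u \<le> s"
begin

lemma ratio_pos: "q > 0"
  using base ratio by auto

definition weight :: "nat \<Rightarrow> ennreal" where
  "weight k = ennreal (q powr e) ^ k"

definition orbit_sum :: "(real \<Rightarrow> ennreal) \<Rightarrow> real \<Rightarrow> ennreal" where
  "orbit_sum h s = (\<Sum>k. weight k * h (q ^ k * s))"

lemma cells_measurable [measurable]: "J \<in> sets lebesgue" "J' \<in> sets lebesgue"
  using tiling tiling' by (auto simp: geometric_tiling_def)

lemma orbit_sum_measurable [measurable]:
  "h \<in> borel_measurable lebesgue \<Longrightarrow> orbit_sum h \<in> borel_measurable lebesgue"
  unfolding orbit_sum_def[abs_def] by measurable

lemma mellin_eq_orbit_sum: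
  assumes "h \<in> borel_measurable lebesgue"
  shows "mellin e D h = mellin e J (orbit_sum h)" "mellin e D' h = mellin e J' (orbit_sum h)"
  using mellin_fold[OF ratio_pos tiling assms] mellin_fold[OF ratio_pos tiling' assms]
  by (simp_all add: orbit_sum_def[abs_def] weight_def)

lemma mellin_one:
  "mellin e D' (\<lambda>_. 1) = mellin e J' (\<lambda>_. 1) * (\<Sum>k. weight k)"
  using mellin_cmult[of "\<lambda>_. 1" J' e "\<Sum>k. weight k"]
  by (subst mellin_eq_orbit_sum) (auto simp: orbit_sum_def[abs_def] mult.commute)

lemma mellin_const:
  "mellin e J' (\<lambda>_. C) = mellin e J' (\<lambda>_. 1) * C"
  using mellin_cmult[of "\<lambda>_. 1" J' e C] by (simp add: mult.commute)

text \<open>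
  Both sides of the product estimates, written as integrals over the same cell \<open>J\<close>. The estimates can then be
  proved pointwise in \<open>s \<in> J\<close>.
\<close>

lemma product_integral_eq:
  fixes F G :: "real \<Rightarrow> ennreal"
  assumes [measurable]: "F \<in> borel_measurable lebesgue" "G \<in> borel_measurable lebesgue"
  shows "mellin e D' (\<lambda>_. 1) * mellin e D (\<lambda>t. G t * F t)
       = mellin e J (\<lambda>s. mellin e J' (\<lambda>_. 1) * ((\<Sum>k. weight k) * orbit_sum (\<lambda>t. G t * F t) s))"
    and "mellin e D G * mellin e D' F = mellin e J (\<lambda>s. mellin e D' F * orbit_sum G s)"
proof -
  show "mellin e D' (\<lambda>_. 1) * mellin e D (\<lambda>t. G t * F t)
      = mellin e J (\<lambda>s. mellin e J' (\<lambda>_. 1) * ((\<Sum>k. weight k) * orbit_sum (\<lambda>t. G t * F t) s))"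
    unfolding mellin_one by (simp add: mellin_eq_orbit_sum(1)[of "\<lambda>t. G t * F t"] mellin_cmult mult.assoc)
  show "mellin e D G * mellin e D' F = mellin e J (\<lambda>s. mellin e D' F * orbit_sum G s)"
    by (simp add: mellin_cmult mellin_eq_orbit_sum(1)[of G] mult.commute)
qed

text \<open>
  Chebyshev's inequality on the orbit of \<open>s\<close> separates \<open>G\<close> from \<open>F\<close>, and \<open>shift\<close> bounds the
  orbit sum of \<open>F\<close> at \<open>s\<close> by its values on all of \<open>J'\<close>; integrating over \<open>J'\<close> turns this into a bound by the
  integral of \<open>F\<close> over \<open>D'\<close>.
\<close>

lemma product_le:
  fixes F G :: "real \<Rightarrow> ennreal"
  assumes [measurable]: "F \<in> borel_measurable lebesgue" "G \<in> borel_measurable lebesgue"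
    and opposite: "\<And>s j k. s \<in> J \<Longrightarrow>
      G (q ^ j * s) * F (q ^ j * s) + G (q ^ k * s) * F (q ^ k * s)
        \<le> G (q ^ j * s) * F (q ^ k * s) + G (q ^ k * s) * F (q ^ j * s)"
    and shift: "\<And>s u k. s \<in> J \<Longrightarrow> u \<in> J' \<Longrightarrow> F (q ^ k * s) \<le> F (q ^ k * u)"
  shows "mellin e D' (\<lambda>_. 1) * mellin e D (\<lambda>t. G t * F t) \<le> mellin e D G * mellin e D' F"
  unfolding product_integral_eq[OF assms(1,2)]
proof (rule mellin_mono)
  fix s assume s: "s \<in> J"
  let ?N = "mellin e J' (\<lambda>_. 1)"
  have average: "?N * orbit_sum F s \<le> mellin e D' F"
    unfolding mellin_const[symmetric] mellin_eq_orbit_sum(2)[OF assms(1)] orbit_sum_def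
    by (intro mellin_mono suminf_le summableI mult_left_mono shift s) auto
  have "?N * ((\<Sum>k. weight k) * orbit_sum (\<lambda>t. G t * F t) s) \<le> ?N * (orbit_sum G s * orbit_sum F s)"
    unfolding orbit_sum_def
    by (intro mult_left_mono Chebyshev_suminf_le opposite[OF s]) auto
  also have "\<dots> = (?N * orbit_sum F s) * orbit_sum G s"
    by (simp add: ac_simps)
  also have "\<dots> \<le> mellin e D' F * orbit_sum G s"
    by (rule mult_right_mono[OF average]) simp
  finally show "?N * ((\<Sum>k. weight k) * orbit_sum (\<lambda>t. G t * F t) s) \<le> mellin e D' F * orbit_sum G s" .
qed

lemma product_ge:
  fixes F G :: "real \<Rightarrow> ennreal"
  assumes [measurable]: "F \<in> borel_measurable lebesgue" "G \<in> borel_measurable lebesgue"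
    and similar: "\<And>s j k. s \<in> J \<Longrightarrow>
      G (q ^ j * s) * F (q ^ k * s) + G (q ^ k * s) * F (q ^ j * s)
        \<le> G (q ^ j * s) * F (q ^ j * s) + G (q ^ k * s) * F (q ^ k * s)"
    and shift: "\<And>s u k. s \<in> J \<Longrightarrow> u \<in> J' \<Longrightarrow> F (q ^ k * u) \<le> F (q ^ k * s)"
  shows "mellin e D G * mellin e D' F \<le> mellin e D' (\<lambda>_. 1) * mellin e D (\<lambda>t. G t * F t)"
  unfolding product_integral_eq[OF assms(1,2)]
proof (rule mellin_mono)
  fix s assume s: "s \<in> J"
  let ?N = "mellin e J' (\<lambda>_. 1)"
  have average: "mellin e D' F \<le> ?N * orbit_sum F s"
    unfolding mellin_const[symmetric] mellin_eq_orbit_sum(2)[OF assms(1)] orbit_sum_def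
    by (intro mellin_mono suminf_le summableI mult_left_mono shift s) auto
  have "mellin e D' F * orbit_sum G s \<le> (?N * orbit_sum F s) * orbit_sum G s"
    by (rule mult_right_mono[OF average]) simp
  also have "\<dots> = ?N * (orbit_sum G s * orbit_sum F s)"
    by (simp add: ac_simps)
  also have "\<dots> \<le> ?N * ((\<Sum>k. weight k) * orbit_sum (\<lambda>t. G t * F t) s)"
    unfolding orbit_sum_def
    by (intro mult_left_mono Chebyshev_suminf_ge similar[OF s]) auto
  finally show "mellin e D' F * orbit_sum G s \<le> ?N * ((\<Sum>k. weight k) * orbit_sum (\<lambda>t. G t * F t) s)" .
qed

lemma orbit_shift_le: "s \<in> J \<Longrightarrow> u \<in> J' \<Longrightarrow> q ^ k * u \<le> q ^ k * s"
  using cell_order ratio_pos by simp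

lemma orbit_increasing:
  fixes G :: "real \<Rightarrow> ennreal"
  assumes "\<forall>t>0. G t \<le> G (c * t)" "s \<in> J" "q ^ j * s \<le> q ^ k * s"
  shows "G (q ^ j * s) \<le> G (q ^ k * s)"
proof (rule adically_increasing_powers[OF base ratio])
  show "0 < s"
    using assms tiling by (auto simp: geometric_tiling_def)
qed (use assms in auto)

text \<open>
  Along each orbit both \<open>F\<close> and \<open>G\<close> increase with the position of the point, whichever way the
  orbit runs, so they are similarly ordered; for an antitone \<open>F\<close> they are oppositely ordered.
\<close>

lemma mono_product_ge:
  fixes F G :: "real \<Rightarrow> ennreal"
  assumes "F \<in> borel_measurable lebesgue" "G \<in> borel_measurable lebesgue"
    and F: "mono F" and G: "\<forall>t>0. G t \<le> G (c * t)"
  shows "mellin e D G * mellin e D' F \<le> mellin e D' (\<lambda>_. 1) * mellin e D (\<lambda>t. G t * F t)"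
proof (rule product_ge[OF assms(1,2)])
  fix s j k assume s: "s \<in> J"
  let ?x = "q ^ j * s" and ?y = "q ^ k * s"
  show "G ?x * F ?y + G ?y * F ?x \<le> G ?x * F ?x + G ?y * F ?y"
  proof (cases "?x \<le> ?y")
    case True
    then show ?thesis
      by (intro rearrangement_ennreal orbit_increasing[OF G s] monoD[OF F])
  next
    case False
    then have "G ?y * F ?x + G ?x * F ?y \<le> G ?y * F ?y + G ?x * F ?x"
      by (intro rearrangement_ennreal orbit_increasing[OF G s] monoD[OF F]) auto
    then show ?thesis
      by (simp add: add.commute)
  qed
qed (intro monoD[OF F] orbit_shift_le)

lemma antimono_product_le:
  fixes F G :: "real \<Rightarrow> ennreal"
  assumes "F \<in> borel_measurable lebesgue" "G \<in> borel_measurable lebesgue"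
    and F: "antimono F" and G: "\<forall>t>0. G t \<le> G (c * t)"
  shows "mellin e D' (\<lambda>_. 1) * mellin e D (\<lambda>t. G t * F t) \<le> mellin e D G * mellin e D' F"
proof (rule product_le[OF assms(1,2)])
  fix s j k assume s: "s \<in> J"
  let ?x = "q ^ j * s" and ?y = "q ^ k * s"
  show "G ?x * F ?x + G ?y * F ?y \<le> G ?x * F ?y + G ?y * F ?x"
  proof (cases "?x \<le> ?y")
    case True
    then show ?thesis
      by (intro rearrangement_ennreal orbit_increasing[OF G s] antimonoD[OF F])
  next
    case False
    then have "G ?y * F ?y + G ?x * F ?x \<le> G ?y * F ?x + G ?x * F ?y"
      by (intro rearrangement_ennreal orbit_increasing[OF G s] antimonoD[OF F]) auto
    then show ?thesis
      by (simp add: add.commute)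
  qed
qed (intro antimonoD[OF F] orbit_shift_le)

lemma domain_measurable [measurable]: "D \<in> sets lebesgue" "D' \<in> sets lebesgue"
  using geometric_tiling_measurable tiling tiling' by auto

lemma domain_pos: "t \<in> D \<Longrightarrow> 0 < t" "t \<in> D' \<Longrightarrow> 0 < t"
  using geometric_tiling_pos[OF ratio_pos tiling] geometric_tiling_pos[OF ratio_pos tiling'] by auto

text \<open>
  The envelope is used on both sides: it dominates \<open>f\<close> in the integral over \<open>D'\<close> and is dominated by
  \<open>B * f\<close> in the integral over \<open>D\<close>. Hence a single factor \<open>B\<close>. In the almost decreasing case the two domains
  exchange roles.
\<close>

lemma almost_increasing_product_ge:
  fixes f g :: "real \<Rightarrow> ennreal"
  assumes [measurable]: "f \<in> borel_measurable lebesgue" "g \<in> borel_measurable lebesgue"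
    and f: "\<And>x y. 0 < x \<Longrightarrow> x \<le> y \<Longrightarrow> f x \<le> B * f y"
    and g: "\<forall>t>0. g t \<le> g (c * t)"
  shows "mellin e D g * mellin e D' f \<le> B * (mellin e D' (\<lambda>_. 1) * mellin e D (\<lambda>t. g t * f t))"
proof -
  obtain F where F: "mono F" and [measurable]: "F \<in> borel_measurable lebesgue"
    and lower: "\<And>x. 0 < x \<Longrightarrow> f x \<le> F x" and upper: "\<And>x. 0 < x \<Longrightarrow> F x \<le> B * f x"
    using almost_increasing_envelope[of f B] f by blast
  have "mellin e D g * mellin e D' f \<le> mellin e D g * mellin e D' F"
    by (intro mult_left_mono mellin_mono lower domain_pos) auto
  also have "\<dots> \<le> mellin e D' (\<lambda>_. 1) * mellin e D (\<lambda>t. g t * F t)"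
    by (rule mono_product_ge) (use F g in auto)
  also have "\<dots> \<le> mellin e D' (\<lambda>_. 1) * mellin e D (\<lambda>t. B * (g t * f t))"
    by (intro mult_left_mono mellin_mono)
       (auto simp: mult.left_commute[of B] intro!: mult_left_mono[OF upper] domain_pos(1))
  also have "\<dots> = B * (mellin e D' (\<lambda>_. 1) * mellin e D (\<lambda>t. g t * f t))"
    by (simp add: mellin_cmult ac_simps)
  finally show ?thesis .
qed

lemma almost_decreasing_product_le:
  fixes f g :: "real \<Rightarrow> ennreal"
  assumes [measurable]: "f \<in> borel_measurable lebesgue" "g \<in> borel_measurable lebesgue"
    and f: "\<And>x y. 0 < x \<Longrightarrow> x \<le> y \<Longrightarrow> f y \<le> B * f x"
    and g: "\<forall>t>0. g t \<le> g (c * t)"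
  shows "mellin e D' (\<lambda>_. 1) * mellin e D (\<lambda>t. g t * f t) \<le> B * (mellin e D g * mellin e D' f)"
proof -
  obtain F where F: "antimono F" and [measurable]: "F \<in> borel_measurable lebesgue"
    and lower: "\<And>x. 0 < x \<Longrightarrow> f x \<le> F x" and upper: "\<And>x. 0 < x \<Longrightarrow> F x \<le> B * f x"
    using almost_decreasing_envelope[of f B] f by blast
  have "mellin e D' (\<lambda>_. 1) * mellin e D (\<lambda>t. g t * f t)
      \<le> mellin e D' (\<lambda>_. 1) * mellin e D (\<lambda>t. g t * F t)"
    by (intro mult_left_mono mellin_mono lower domain_pos) auto
  also have "\<dots> \<le> mellin e D g * mellin e D' F"
    by (rule antimono_product_le) (use F g in auto)
  also have "\<dots> \<le> mellin e D g * mellin e D' (\<lambda>t. B * f t)"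
    by (intro mult_left_mono mellin_mono) (auto intro: upper domain_pos)
  also have "\<dots> = B * (mellin e D g * mellin e D' f)"
    by (simp add: mellin_cmult ac_simps)
  finally show ?thesis .
qed

text \<open>
  Solving for the integral of \<open>g f\<close>: the natural constant is \<open>1 / (b N)\<close>, and any smaller \<open>K\<close> will do; dually,
  in the almost decreasing case, any \<open>K\<close> that is at least \<open>b / N\<close>.
\<close>

lemma almost_increasing_average_ge:
  fixes f g :: "real \<Rightarrow> real"
  assumes f: "f \<in> {0<..} \<rightarrow> {0..}" "f \<in> borel_measurable (lebesgue_on {0<..})"
    and g: "g \<in> {0<..} \<rightarrow> {0..}" "g \<in> borel_measurable (lebesgue_on {0<..})"
      "adically_increasing c g"
    and b: "0 \<le> b" "almost_increasing b f"
    and N: "mellin e D' (\<lambda>_. 1) = ennreal N" "0 \<le> N"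
    and K: "0 \<le> K" "K * b * N \<le> 1"
  shows "ennreal K * (\<integral>\<^sup>+t\<in>D. ennreal (g t * t powr (e - 1)) \<partial>lebesgue)
             * (\<integral>\<^sup>+t\<in>D'. ennreal (f t * t powr (e - 1)) \<partial>lebesgue)
       \<le> (\<integral>\<^sup>+t\<in>D. ennreal (g t * f t * t powr (e - 1)) \<partial>lebesgue)"
proof -
  let ?f = "zero_ext f" and ?g = "zero_ext g"
  have "ennreal K * (mellin e D ?g * mellin e D' ?f)
      \<le> ennreal K * (ennreal b * (ennreal N * mellin e D (\<lambda>t. ?g t * ?f t)))"
    unfolding N(1)[symmetric]
  proof (intro mult_left_mono almost_increasing_product_ge)
    show "?f x \<le> ennreal b * ?f y" if "0 < x" "x \<le> y" for x y
      using b f(1) that by (auto simp: zero_ext_def almost_increasing_def Pi_iff simp flip: ennreal_mult intro!: ennreal_leI)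
    show "\<forall>t>0. ?g t \<le> ?g (c * t)"
      using g base by (auto simp: zero_ext_def adically_increasing_def intro: ennreal_leI)
  qed (use f g in \<open>auto intro: zero_ext_measurable\<close>)
  also have "\<dots> = ennreal (K * b * N) * mellin e D (\<lambda>t. ?g t * ?f t)"
    using K b N by (simp add: ennreal_mult mult.assoc)
  also have "\<dots> \<le> 1 * mellin e D (\<lambda>t. ?g t * ?f t)"
    using K(2) by (intro mult_right_mono) auto
  finally show ?thesis
    using f(1) g(1) by (simp add: mellin_zero_ext mellin_zero_ext_product domain_pos subsetI mult.assoc)
qed

lemma almost_decreasing_average_le:
  fixes f g :: "real \<Rightarrow> real"
  assumes f: "f \<in> {0<..} \<rightarrow> {0..}" "f \<in> borel_measurable (lebesgue_on {0<..})"
    and g: "g \<in> {0<..} \<rightarrow> {0..}" "g \<in> borel_measurable (lebesgue_on {0<..})"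
      "adically_increasing c g"
    and b: "0 \<le> b" "almost_decreasing b f"
    and N: "mellin e D' (\<lambda>_. 1) = ennreal N" "0 < N"
    and K: "b \<le> K * N"
  shows "(\<integral>\<^sup>+t\<in>D. ennreal (g t * f t * t powr (e - 1)) \<partial>lebesgue)
      \<le> ennreal K * (\<integral>\<^sup>+t\<in>D. ennreal (g t * t powr (e - 1)) \<partial>lebesgue)
             * (\<integral>\<^sup>+t\<in>D'. ennreal (f t * t powr (e - 1)) \<partial>lebesgue)"
proof -
  let ?f = "zero_ext f" and ?g = "zero_ext g"
  have "mellin e D (\<lambda>t. ?g t * ?f t) = ennreal (1 / N) * (ennreal N * mellin e D (\<lambda>t. ?g t * ?f t))"
    using N(2) by (simp flip: mult.assoc ennreal_mult)
  also have "\<dots> \<le> ennreal (1 / N) * (ennreal b * (mellin e D ?g * mellin e D' ?f))"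
    unfolding N(1)[symmetric]
  proof (intro mult_left_mono almost_decreasing_product_le)
    show "?f y \<le> ennreal b * ?f x" if "0 < x" "x \<le> y" for x y
      using b f(1) that by (auto simp: zero_ext_def almost_decreasing_def Pi_iff simp flip: ennreal_mult intro!: ennreal_leI)
    show "\<forall>t>0. ?g t \<le> ?g (c * t)"
      using g base by (auto simp: zero_ext_def adically_increasing_def intro: ennreal_leI)
  qed (use f g in \<open>auto intro: zero_ext_measurable\<close>)
  also have "\<dots> = ennreal (b / N) * (mellin e D ?g * mellin e D' ?f)"
    using N(2) b by (simp flip: mult.assoc ennreal_mult)
  also have "\<dots> \<le> ennreal K * (mellin e D ?g * mellin e D' ?f)"
    using N(2) K by (intro mult_right_mono ennreal_leI) (auto simp: field_simps)
  finally show ?thesis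
    using f(1) g(1) by (simp add: mellin_zero_ext mellin_zero_ext_product domain_pos subsetI mult.assoc)
qed

end

section \<open>The two half-lines\<close>

lemma two_tilings_towards_zero:
  assumes "c > 1" "r > 0"
  shows "two_tilings c (1 / c) {r / c..<r} {0<..<r} {r / c / c..<r / c} {0<..<r / c}"
  using assms tiling_towards_zero[of c r] tiling_towards_zero[of c "r / c"]
  by unfold_locales auto

lemma two_tilings_towards_infinity:
  assumes "c > 1" "r > 0"
  shows "two_tilings c c {r<..r * c} {r<..} {r / c<..r} {r / c<..}"
  using assms tiling_towards_infinity[of c r] tiling_towards_infinity[of c "r / c"]
  by unfold_locales auto

lemma mellin_one_towards_zero:
  assumes "a > 0" "r > 0"
  shows "mellin a {0<..<r} (\<lambda>_. 1) = ennreal (r powr a / a)"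
proof -
  have "((\<lambda>t. t powr (a - 1)) has_integral r powr a / a) {0..r}"
    using has_integral_powr_from_0[of "a - 1" r] assms by simp
  then have "((\<lambda>t. t powr (a - 1)) has_integral r powr a / a) {0<..<r}"
    by (simp add: has_integral_Icc_iff_Ioo)
  from nn_integral_has_integral_lebesgue'[OF _ this] show ?thesis
    by (simp add: mellin_def nn_integral_completion)
qed

lemma mellin_one_towards_infinity:
  assumes "a > 0" "r > 0"
  shows "mellin (- a) {r<..} (\<lambda>_. 1) = ennreal (r powr (- a) / a)"
proof -
  have "((\<lambda>t. t powr (- a - 1)) has_integral r powr (- a) / a) {r..}"
    using has_integral_powr_to_inf[of "- a - 1" r] assms by simp
  moreover have "negligible {t \<in> {r..} - {r<..}. t powr (- a - 1) \<noteq> 0}"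
    by (rule negligible_subset[of "{r}"]) auto
  moreover have "negligible {t \<in> {r<..} - {r..}. t powr (- a - 1) \<noteq> 0}"
    by (rule negligible_subset[of "{}"]) auto
  ultimately have "((\<lambda>t. t powr (- a - 1)) has_integral r powr (- a) / a) {r<..}"
    by (simp only: has_integral_spike_set_eq[of "{r..}" "{r<..}" "\<lambda>t. t powr (- a - 1)"])
  from nn_integral_has_integral_lebesgue'[OF _ this] show ?thesis
    by (simp add: mellin_def nn_integral_completion)
qed

theorem theorem2p17:
  fixes a r b c :: real and f g :: "real \<Rightarrow> real"
  assumes "a > 0" and "r > 0" and "b > 1" and "c > 1"
    and "f \<in> {0<..} \<rightarrow> {0..}" and "g \<in> {0<..} \<rightarrow> {0..}"
    and "f \<in> borel_measurable (lebesgue_on {0<..})"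
    and "g \<in> borel_measurable (lebesgue_on {0<..})"
    and "adically_increasing c g"
  shows
    "((almost_increasing b f \<longrightarrow>
        (\<integral>\<^sup>+t\<in>{0<..<r}. ennreal (g t * f t * t powr (a - 1)) \<partial>lebesgue)
          \<ge> ennreal (a * (r / c) powr (- a) / b ^ 3)
            * (\<integral>\<^sup>+t\<in>{0<..<r}. ennreal (g t * t powr (a - 1)) \<partial>lebesgue)
            * (\<integral>\<^sup>+t\<in>{0<..<r / c}. ennreal (f t * t powr (a - 1)) \<partial>lebesgue) \<and>
        (\<integral>\<^sup>+t\<in>{r<..}. ennreal (g t * f t * t powr (- a - 1)) \<partial>lebesgue)
          \<ge> ennreal (a * (r / c) powr a / b ^ 3)
            * (\<integral>\<^sup>+t\<in>{r<..}. ennreal (g t * t powr (- a - 1)) \<partial>lebesgue)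
            * (\<integral>\<^sup>+t\<in>{r / c<..}. ennreal (f t * t powr (- a - 1)) \<partial>lebesgue)) \<and>
      (almost_decreasing b f \<longrightarrow>
        (\<integral>\<^sup>+t\<in>{0<..<r}. ennreal (g t * f t * t powr (a - 1)) \<partial>lebesgue)
          \<le> ennreal (a * (r / c) powr (- a) * b ^ 3)
            * (\<integral>\<^sup>+t\<in>{0<..<r}. ennreal (g t * t powr (a - 1)) \<partial>lebesgue)
            * (\<integral>\<^sup>+t\<in>{0<..<r / c}. ennreal (f t * t powr (a - 1)) \<partial>lebesgue) \<and>
        (\<integral>\<^sup>+t\<in>{r<..}. ennreal (g t * f t * t powr (- a - 1)) \<partial>lebesgue)
          \<le> ennreal (a * (r / c) powr a * b ^ 3)
            * (\<integral>\<^sup>+t\<in>{r<..}. ennreal (g t * t powr (- a - 1)) \<partial>lebesgue)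
            * (\<integral>\<^sup>+t\<in>{r / c<..}. ennreal (f t * t powr (- a - 1)) \<partial>lebesgue))) \<and>
     (mono_on {0<..} g \<or> antimono_on {0<..} g \<longrightarrow>
      (almost_increasing b f \<longrightarrow>
        (\<integral>\<^sup>+t\<in>{0<..<r}. ennreal (g t * f t * t powr (a - 1)) \<partial>lebesgue)
          \<ge> ennreal (a * (r / c) powr (- a) / b)
            * (\<integral>\<^sup>+t\<in>{0<..<r}. ennreal (g t * t powr (a - 1)) \<partial>lebesgue)
            * (\<integral>\<^sup>+t\<in>{0<..<r / c}. ennreal (f t * t powr (a - 1)) \<partial>lebesgue) \<and>
        (\<integral>\<^sup>+t\<in>{r<..}. ennreal (g t * f t * t powr (- a - 1)) \<partial>lebesgue)
          \<ge> ennreal (a * (r / c) powr a / b)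
            * (\<integral>\<^sup>+t\<in>{r<..}. ennreal (g t * t powr (- a - 1)) \<partial>lebesgue)
            * (\<integral>\<^sup>+t\<in>{r / c<..}. ennreal (f t * t powr (- a - 1)) \<partial>lebesgue)) \<and>
      (almost_decreasing b f \<longrightarrow>
        (\<integral>\<^sup>+t\<in>{0<..<r}. ennreal (g t * f t * t powr (a - 1)) \<partial>lebesgue)
          \<le> ennreal (a * (r / c) powr (- a) * b)
            * (\<integral>\<^sup>+t\<in>{0<..<r}. ennreal (g t * t powr (a - 1)) \<partial>lebesgue)
            * (\<integral>\<^sup>+t\<in>{0<..<r / c}. ennreal (f t * t powr (a - 1)) \<partial>lebesgue) \<and>
        (\<integral>\<^sup>+t\<in>{r<..}. ennreal (g t * f t * t powr (- a - 1)) \<partial>lebesgue)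
          \<le> ennreal (a * (r / c) powr a * b)
            * (\<integral>\<^sup>+t\<in>{r<..}. ennreal (g t * t powr (- a - 1)) \<partial>lebesgue)
            * (\<integral>\<^sup>+t\<in>{r / c<..}. ennreal (f t * t powr (- a - 1)) \<partial>lebesgue)))"
proof -
  note f = \<open>f \<in> {0<..} \<rightarrow> {0..}\<close> \<open>f \<in> borel_measurable (lebesgue_on {0<..})\<close>
  note g = \<open>g \<in> {0<..} \<rightarrow> {0..}\<close> \<open>g \<in> borel_measurable (lebesgue_on {0<..})\<close>
    \<open>adically_increasing c g\<close>
  have rc: "0 < r / c" and b: "0 \<le> b"
    using assms by auto
  interpret zero: two_tilings c "1 / c" a "{r / c..<r}" "{0<..<r}" "{r / c / c..<r / c}" "{0<..<r / c}"
    using assms by (intro two_tilings_towards_zero)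
  interpret infinity: two_tilings c c "- a" "{r<..r * c}" "{r<..}" "{r / c<..r}" "{r / c<..}"
    using assms by (intro two_tilings_towards_infinity)
  note N0 = mellin_one_towards_zero[OF \<open>a > 0\<close> rc]
  note Ninf = mellin_one_towards_infinity[OF \<open>a > 0\<close> rc]
  have pos: "0 < (r / c) powr a / a" "0 < (r / c) powr (- a) / a"
    using assms by auto
  have inverse: "(r / c) powr (- a) * (r / c) powr a = 1"
    using assms by (simp flip: powr_add)
  have cube: "b \<le> b ^ 3"
    using \<open>b > 1\<close> by (simp add: self_le_power)
  \<comment> \<open>In the next two facts \<open>p' / a\<close> is the integral of the weight over \<open>D'\<close>.\<close>
  have lower: "a * p / B * b * (p' / a) \<le> 1" if "p * p' = 1" "b \<le> B" for p p' B
  proof -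
    have "a * p / B * b * (p' / a) = (p * p') * (b / B)"
      using \<open>a > 0\<close> by simp
    then show ?thesis
      using that \<open>b > 1\<close> by simp
  qed
  have upper: "b \<le> a * p * B * (p' / a)" if "p * p' = 1" "b \<le> B" for p p' B
  proof -
    have "a * p * B * (p' / a) = (p * p') * B"
      using \<open>a > 0\<close> by simp
    then show ?thesis
      using that by simp
  qed
  \<comment> \<open>The constant \<open>B\<close> is left open so that \<open>b ^ 3\<close> and \<open>b\<close> are covered by one argument.\<close>
  have bounds:
    "(almost_increasing b f \<longrightarrow>
        (\<integral>\<^sup>+t\<in>{0<..<r}. ennreal (g t * f t * t powr (a - 1)) \<partial>lebesgue)
          \<ge> ennreal (a * (r / c) powr (- a) / B)
            * (\<integral>\<^sup>+t\<in>{0<..<r}. ennreal (g t * t powr (a - 1)) \<partial>lebesgue)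
            * (\<integral>\<^sup>+t\<in>{0<..<r / c}. ennreal (f t * t powr (a - 1)) \<partial>lebesgue) \<and>
        (\<integral>\<^sup>+t\<in>{r<..}. ennreal (g t * f t * t powr (- a - 1)) \<partial>lebesgue)
          \<ge> ennreal (a * (r / c) powr a / B)
            * (\<integral>\<^sup>+t\<in>{r<..}. ennreal (g t * t powr (- a - 1)) \<partial>lebesgue)
            * (\<integral>\<^sup>+t\<in>{r / c<..}. ennreal (f t * t powr (- a - 1)) \<partial>lebesgue)) \<and>
      (almost_decreasing b f \<longrightarrow>
        (\<integral>\<^sup>+t\<in>{0<..<r}. ennreal (g t * f t * t powr (a - 1)) \<partial>lebesgue)
          \<le> ennreal (a * (r / c) powr (- a) * B)
            * (\<integral>\<^sup>+t\<in>{0<..<r}. ennreal (g t * t powr (a - 1)) \<partial>lebesgue)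
            * (\<integral>\<^sup>+t\<in>{0<..<r / c}. ennreal (f t * t powr (a - 1)) \<partial>lebesgue) \<and>
        (\<integral>\<^sup>+t\<in>{r<..}. ennreal (g t * f t * t powr (- a - 1)) \<partial>lebesgue)
          \<le> ennreal (a * (r / c) powr a * B)
            * (\<integral>\<^sup>+t\<in>{r<..}. ennreal (g t * t powr (- a - 1)) \<partial>lebesgue)
            * (\<integral>\<^sup>+t\<in>{r / c<..}. ennreal (f t * t powr (- a - 1)) \<partial>lebesgue))"
    if B: "b \<le> B" for B
  proof (intro conjI impI)
    have K: "0 \<le> a * (r / c) powr (- a) / B" "0 \<le> a * (r / c) powr a / B"
      using assms B by auto
    have inverse': "(r / c) powr a * (r / c) powr (- a) = 1"
      using inverse by (simp add: mult.commute)
    note zero.almost_increasing_average_ge[OF f g b _ N0 less_imp_le[OF pos(1)] K(1) lower[OF inverse B]]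
      infinity.almost_increasing_average_ge[OF f g b _ Ninf less_imp_le[OF pos(2)] K(2) lower[OF inverse' B]]
    moreover assume "almost_increasing b f"
    ultimately show "ennreal (a * (r / c) powr (- a) / B)
            * (\<integral>\<^sup>+t\<in>{0<..<r}. ennreal (g t * t powr (a - 1)) \<partial>lebesgue)
            * (\<integral>\<^sup>+t\<in>{0<..<r / c}. ennreal (f t * t powr (a - 1)) \<partial>lebesgue)
        \<le> (\<integral>\<^sup>+t\<in>{0<..<r}. ennreal (g t * f t * t powr (a - 1)) \<partial>lebesgue)"
      "ennreal (a * (r / c) powr a / B)
            * (\<integral>\<^sup>+t\<in>{r<..}. ennreal (g t * t powr (- a - 1)) \<partial>lebesgue)
            * (\<integral>\<^sup>+t\<in>{r / c<..}. ennreal (f t * t powr (- a - 1)) \<partial>lebesgue)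
        \<le> (\<integral>\<^sup>+t\<in>{r<..}. ennreal (g t * f t * t powr (- a - 1)) \<partial>lebesgue)"
      by blast+
  next
    have inverse': "(r / c) powr a * (r / c) powr (- a) = 1"
      using inverse by (simp add: mult.commute)
    note zero.almost_decreasing_average_le[OF f g b _ N0 pos(1) upper[OF inverse B]]
      infinity.almost_decreasing_average_le[OF f g b _ Ninf pos(2) upper[OF inverse' B]]
    moreover assume "almost_decreasing b f"
    ultimately show "(\<integral>\<^sup>+t\<in>{0<..<r}. ennreal (g t * f t * t powr (a - 1)) \<partial>lebesgue)
        \<le> ennreal (a * (r / c) powr (- a) * B)
            * (\<integral>\<^sup>+t\<in>{0<..<r}. ennreal (g t * t powr (a - 1)) \<partial>lebesgue)
            * (\<integral>\<^sup>+t\<in>{0<..<r / c}. ennreal (f t * t powr (a - 1)) \<partial>lebesgue)"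
      "(\<integral>\<^sup>+t\<in>{r<..}. ennreal (g t * f t * t powr (- a - 1)) \<partial>lebesgue)
        \<le> ennreal (a * (r / c) powr a * B)
            * (\<integral>\<^sup>+t\<in>{r<..}. ennreal (g t * t powr (- a - 1)) \<partial>lebesgue)
            * (\<integral>\<^sup>+t\<in>{r / c<..}. ennreal (f t * t powr (- a - 1)) \<partial>lebesgue)"
      by blast+
  qed
  show ?thesis
    using bounds[OF cube] bounds[OF order_refl] by blast
qed

end
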